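(* Let $\mathbf b=(b_1,\dots,b_n)\in\mathbb Z_{>0}^n$, let $t$ be a positive integer, and set $\mathbf b^{(t)}:=\bigl(t(b_1-1)+1,\ tb_2,\ tb_3,\dots,tb_n\bigr)\in\mathbb Z_{>0}^n$. Then $$t\,\mathfrak X_n(\mathbf b)=(t-1)\mathbf 1+\mathfrak X_n\bigl(\mathbf b^{(t)}\bigr),$$ where $\mathbf 1=(1,\dots,1)\in\mathbb R^n$. In particular, $\#\bigl(t\,\mathfrak X_n(\mathbf b)\cap\mathbb Z^n\bigr)=\#\bigl(\mathfrak X_n(\mathbf b^{(t)})\cap\mathbb Z^n\bigr)$.
   Context: For $\mathbf b=(b_1,\dots,b_n)\in\mathbb Z_{>0}^n$, a $\mathbf b$-parking function is a list $(\beta_1,\dots,\beta_n)$ of positive integers whose nondecreasing rearrangement $\beta_1'\le\cdots\le\beta_n'$ satisfies $\beta_i'\le b_1+\cdots+b_i$ for all $i$. The $\mathbf b$-parking-function polytope $\mathfrak X_n(\mathbf b)\subset\mathbb R^n$ is the convex hull of all $\mathbf b$-parking functions of length $n$. $tP=\{t\mathbf x:\mathbf x\in P\}$. *)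

theory Defs
  imports "HOL-Analysis.Analysis"
begin

text \<open>The coordinates of \<open>\<real>\<^sup>n\<close> are indexed by an arbitrary finite linearly ordered type
  \<open>'n\<close> with \<open>n = CARD('n)\<close>; its order plays the role of \<open>1 < 2 < \<dots> < n\<close>.  In particular
  \<open>b\<^sub>1 + \<dots> + b\<^sub>i\<close> is \<open>\<Sum>j\<le>i. b $ j\<close>, and the first index is \<open>Min UNIV\<close>.\<close>

definition nondecreasing_rearrangement ::
    "int ^ 'n::{finite,linorder} \<Rightarrow> int ^ 'n::{finite,linorder} \<Rightarrow> bool" where
  "nondecreasing_rearrangement \<beta> \<beta>' \<longleftrightarrow>
     (\<exists>\<sigma>. \<sigma> permutes UNIV \<and> \<beta>' = (\<chi> i. \<beta> $ \<sigma> i)) \<and> mono (\<lambda>i. \<beta>' $ i)"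

text \<open>The rearrangement exists and is unique (as a vector), so it does not matter that it is
  introduced by an existential quantifier here.\<close>

definition parking_function ::
    "int ^ 'n::{finite,linorder} \<Rightarrow> int ^ 'n::{finite,linorder} \<Rightarrow> bool" where
  "parking_function b \<beta> \<longleftrightarrow>
     (\<forall>i. 0 < \<beta> $ i) \<and>
     (\<exists>\<beta>'. nondecreasing_rearrangement \<beta> \<beta>' \<and> (\<forall>i. \<beta>' $ i \<le> (\<Sum>j\<le>i. b $ j)))"

definition parking_polytope :: "int ^ 'n::{finite,linorder} \<Rightarrow> (real ^ 'n::{finite,linorder}) set" where
  "parking_polytope b =
     convex hull {(\<chi> i. real_of_int (\<beta> $ i)) | \<beta>. parking_function b \<beta>}"

definition dilated_params :: "int \<Rightarrow> int ^ 'n::{finite,linorder} \<Rightarrow> int ^ 'n::{finite,linorder}" where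
  "dilated_params t b = (\<chi> i. if i = Min UNIV then t * (b $ i - 1) + 1 else t * b $ i)"

definition integer_points :: "(real ^ 'n::finite) set" where
  "integer_points = {x. \<forall>i. x $ i \<in> \<int>}"

lemma dilated_params_pos:
  fixes b :: "int ^ 'n::{finite,linorder}"
  assumes "\<And>i. 0 < b $ i" and "0 < t"
  shows "0 < dilated_params t b $ i"
proof -
  have "0 \<le> t * (b $ i - 1)"
    using assms(1)[of i] assms(2) by simp
  then show ?thesis
    using assms by (simp add: dilated_params_def)
qed

text \<open>The lattice-point counts are genuine: the sets being counted are finite.\<close>

lemma finite_bounded_int_vectors:
  "finite {\<beta> :: int ^ 'n::finite. \<forall>i. l \<le> \<beta> $ i \<and> \<beta> $ i \<le> u}"
proof -
  have "finite (vec_nth ` {\<beta> :: int ^ 'n. \<forall>i. l \<le> \<beta> $ i \<and> \<beta> $ i \<le> u})"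
    by (rule finite_subset[OF _ finite_PiE[of UNIV "\<lambda>_. {l..u}"]]) auto
  then show ?thesis
    by (rule finite_imageD) (simp add: inj_on_def vec_nth_inject)
qed

lemma finite_integer_points:
  fixes S :: "(real ^ 'n::finite) set"
  assumes "bounded S"
  shows "finite (S \<inter> integer_points)"
proof -
  obtain K where K: "\<And>x. x \<in> S \<Longrightarrow> norm x \<le> K"
    using assms by (auto simp: bounded_iff)
  have "S \<inter> integer_points \<subseteq> (\<lambda>\<beta>. \<chi> i. real_of_int (\<beta> $ i)) `
          {\<beta> :: int ^ 'n. \<forall>i. - \<lceil>K\<rceil> \<le> \<beta> $ i \<and> \<beta> $ i \<le> \<lceil>K\<rceil>}"
  proof
    fix x assume x: "x \<in> S \<inter> integer_points"
    define \<beta> :: "int ^ 'n" where "\<beta> = (\<chi> i. \<lfloor>x $ i\<rfloor>)"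
    have eq: "real_of_int (\<beta> $ i) = x $ i" for i
      using x by (auto simp: \<beta>_def integer_points_def elim!: Ints_cases dest!: spec[of _ i])
    have "\<bar>x $ i\<bar> \<le> K" for i
      using K[of x] x component_le_norm_cart[of x i] by force
    then have "- \<lceil>K\<rceil> \<le> \<beta> $ i \<and> \<beta> $ i \<le> \<lceil>K\<rceil>" for i
      using eq[of i] by (smt (verit) ceiling_le_iff le_of_int_ceiling of_int_le_iff of_int_minus)
    moreover have "x = (\<chi> i. real_of_int (\<beta> $ i))"
      by (simp add: vec_eq_iff eq)
    ultimately show "x \<in> (\<lambda>\<beta>. \<chi> i. real_of_int (\<beta> $ i)) `
          {\<beta> :: int ^ 'n. \<forall>i. - \<lceil>K\<rceil> \<le> \<beta> $ i \<and> \<beta> $ i \<le> \<lceil>K\<rceil>}"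
      by blast
  qed
  then show ?thesis
    using finite_bounded_int_vectors finite_subset by blast
qed

lemma bounded_parking_polytope:
  fixes b :: "int ^ 'n::{finite,linorder}"
  shows "bounded (parking_polytope b)"
proof -
  define u where "u = (\<Sum>j\<in>UNIV. \<bar>b $ j\<bar>)"
  have "0 \<le> \<beta> $ i \<and> \<beta> $ i \<le> u" if "parking_function b \<beta>" for \<beta> i
  proof -
    obtain \<sigma> where pos: "0 < \<beta> $ i" and \<sigma>: "\<sigma> permutes UNIV"
      and le: "\<And>k. \<beta> $ \<sigma> k \<le> (\<Sum>j\<le>k. b $ j)"
      using \<open>parking_function b \<beta>\<close>
      by (auto simp: parking_function_def nondecreasing_rearrangement_def)
    obtain k where k: "i = \<sigma> k"
      using \<sigma> by (metis permutes_surj surjD)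
    have "(\<Sum>j\<le>k. b $ j) \<le> (\<Sum>j\<le>k. \<bar>b $ j\<bar>)"
      by (rule sum_mono) simp
    also have "\<dots> \<le> u"
      unfolding u_def by (rule sum_mono2) auto
    finally show ?thesis
      using pos le[of k] k by simp
  qed
  then have "{\<beta>. parking_function b \<beta>} \<subseteq> {\<beta>. \<forall>i. 0 \<le> \<beta> $ i \<and> \<beta> $ i \<le> u}"
    by blast
  then have "finite {\<beta>. parking_function b \<beta>}"
    using finite_bounded_int_vectors finite_subset by blast
  then show ?thesis
    unfolding parking_polytope_def
    by (intro bounded_convex_hull finite_imp_bounded) (simp add: finite_image_set)
qed

lemma finite_lattice_points:
  fixes b :: "int ^ 'n::{finite,linorder}"
  shows "finite ((*\<^sub>R) r ` parking_polytope b \<inter> integer_points)"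
    and "finite (parking_polytope b \<inter> integer_points)"
  by (simp_all add: finite_integer_points bounded_scaling bounded_parking_polytope)

end

theory Submission
  imports Defs
begin

text \<open>
  A parking function is a positive integer vector lying, up to a permutation of coordinates, below
  the vector \<open>S\<close> of partial sums of \<open>b\<close>: since \<open>S\<close> is nondecreasing, any permutation that fits below
  \<open>S\<close> can be sorted without violating the bounds (\<open>parking_function_iff_fits_below\<close>).
  Consequently the polytope contains, for each permutation \<open>\<sigma>\<close>, the whole real box
  \<open>1 \<le> y\<^bsub>\<sigma>(i)\<^esub> \<le> S\<^sub>i\<close>: all corners of this box are parking functions
  (\<open>permuted_box_in_parking_polytope\<close>).

  The parameters \<open>dilated_params t b\<close> are made so that their partial sums, decreased by 1, are
  exactly \<open>t\<close> times the numbers \<open>S\<^sub>i - 1\<close> (\<open>sum_dilated_params\<close>).  Measured from the point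
  \<open>(1, \<dots>, 1)\<close>, the boxes for the dilated parameters are thus the \<open>t\<close>-fold dilations of the boxes
  for \<open>b\<close>.  Generators of the left-hand polytope are therefore carried to generators of the
  right-hand one, and conversely each generator on the right, shrunk by \<open>t\<close>, lies in one of the
  boxes for \<open>b\<close>, although it need not be an integer point any more.  The counts agree because the
  translation is by an integer vector.
\<close>

text \<open>An exchange argument: among the permutations fitting below \<open>S\<close>, one that maximises the rank
  weighted sum of the entries is sorted.  Swapping an inversion increases that sum, and the swapped
  permutation still fits, because the larger entry moves to a place with a larger bound.\<close>

lemma sorted_permutation_below_mono:
  fixes \<beta> S :: "'n::{finite,linorder} \<Rightarrow> int"
  assumes S: "mono S" and ex: "\<sigma> permutes UNIV" "\<And>i. \<beta> (\<sigma> i) \<le> S i"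
  obtains \<tau> where "\<tau> permutes UNIV" "mono (\<lambda>i. \<beta> (\<tau> i))" "\<And>i. \<beta> (\<tau> i) \<le> S i"
proof -
  define F where "F = {\<sigma>. \<sigma> permutes (UNIV :: 'n set) \<and> (\<forall>i. \<beta> (\<sigma> i) \<le> S i)}"
  define r where "r i = int (card {..<i})" for i :: 'n
  define w where "w \<sigma> = (\<Sum>i\<in>UNIV. r i * \<beta> (\<sigma> i))" for \<sigma>
  have "finite F"
    unfolding F_def by (rule finite_subset[OF _ finite_permutations[of UNIV]]) auto
  moreover have "F \<noteq> {}"
    using ex by (auto simp: F_def)
  ultimately have "Max (w ` F) \<in> w ` F"
    by simp
  then obtain \<tau> where \<tau>: "\<tau> \<in> F" and w_\<tau>: "Max (w ` F) = w \<tau>"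
    by (rule imageE)
  have max: "w \<rho> \<le> w \<tau>" if "\<rho> \<in> F" for \<rho>
    using Max_ge[of "w ` F" "w \<rho>"] \<open>finite F\<close> that by (simp add: w_\<tau>)
  have "\<beta> (\<tau> i) \<le> \<beta> (\<tau> j)" if "i < j" for i j
  proof (rule ccontr)
    assume inv: "\<not> \<beta> (\<tau> i) \<le> \<beta> (\<tau> j)"
    define \<rho> where "\<rho> = \<tau> \<circ> Transposition.transpose i j"
    have "\<rho> permutes UNIV"
      unfolding \<rho>_def using \<tau> by (auto simp: F_def intro!: permutes_compose permutes_swap_id)
    moreover have "\<beta> (\<rho> k) \<le> S k" for k
    proof -
      have fits: "\<beta> (\<tau> k) \<le> S k" for k
        using \<tau> by (simp add: F_def)
      have "S i \<le> S j"
        using S \<open>i < j\<close> by (simp add: monoD)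
      then show ?thesis
        using inv fits[of i] fits[of j] fits[of k] by (auto simp: \<rho>_def Transposition.transpose_def)
    qed
    ultimately have "\<rho> \<in> F"
      by (simp add: F_def)
    have split: "w \<sigma> =
        r i * \<beta> (\<sigma> i) + r j * \<beta> (\<sigma> j) + (\<Sum>k\<in>UNIV - {i, j}. r k * \<beta> (\<sigma> k))" for \<sigma>
      unfolding w_def using sum.subset_diff[of "{i, j}" UNIV "\<lambda>k. r k * \<beta> (\<sigma> k)"] \<open>i < j\<close> by simp
    have "(\<Sum>k\<in>UNIV - {i, j}. r k * \<beta> (\<rho> k)) = (\<Sum>k\<in>UNIV - {i, j}. r k * \<beta> (\<tau> k))"
      by (rule sum.cong) (auto simp: \<rho>_def Transposition.transpose_def)
    moreover have "\<rho> i = \<tau> j" "\<rho> j = \<tau> i"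
      by (simp_all add: \<rho>_def)
    ultimately have diff: "w \<rho> - w \<tau> = (r j - r i) * (\<beta> (\<tau> i) - \<beta> (\<tau> j))"
      by (simp add: split[of \<rho>] split[of \<tau>] algebra_simps)
    have "r i < r j"
      unfolding r_def of_nat_less_iff using \<open>i < j\<close> by (intro psubset_card_mono) auto
    then have "0 < w \<rho> - w \<tau>"
      using inv unfolding diff by simp
    then show False
      using max[OF \<open>\<rho> \<in> F\<close>] by simp
  qed
  then have "mono (\<lambda>i. \<beta> (\<tau> i))"
    by (metis monoI order.order_iff_strict)
  then show ?thesis
    using \<tau> that by (auto simp: F_def)
qed

lemma mono_partial_sums:
  fixes b :: "int ^ 'n::{finite,linorder}"
  assumes "\<And>i. 0 < b $ i"
  shows "mono (\<lambda>i. \<Sum>j\<le>i. b $ j)"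
  by (rule monoI, rule sum_mono2) (use assms in \<open>auto intro: less_imp_le\<close>)

text \<open>Dropping the sortedness requirement makes it possible to recognise a parking function, such as
  a corner of a box, from any permutation at hand.\<close>

lemma parking_function_iff_fits_below:
  fixes b :: "int ^ 'n::{finite,linorder}"
  assumes "\<And>i. 0 < b $ i"
  shows "parking_function b \<beta> \<longleftrightarrow>
    (\<forall>i. 0 < \<beta> $ i) \<and> (\<exists>\<sigma>. \<sigma> permutes UNIV \<and> (\<forall>i. \<beta> $ \<sigma> i \<le> (\<Sum>j\<le>i. b $ j)))"
    (is "_ \<longleftrightarrow> ?R")
proof
  assume "parking_function b \<beta>"
  then show ?R
    by (auto simp: parking_function_def nondecreasing_rearrangement_def)
next
  assume R: ?R
  then obtain \<sigma> where "\<sigma> permutes UNIV" "\<And>i. \<beta> $ \<sigma> i \<le> (\<Sum>j\<le>i. b $ j)"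
    by blast
  then obtain \<tau> where \<tau>: "\<tau> permutes UNIV" "mono (\<lambda>i. \<beta> $ \<tau> i)"
      "\<And>i. \<beta> $ \<tau> i \<le> (\<Sum>j\<le>i. b $ j)"
    using sorted_permutation_below_mono[OF mono_partial_sums[OF assms], of \<sigma> "\<lambda>i. \<beta> $ i"] by blast
  then have "nondecreasing_rearrangement \<beta> (\<chi> i. \<beta> $ \<tau> i)"
    by (auto simp: nondecreasing_rearrangement_def)
  with R \<tau>(3) show "parking_function b \<beta>"
    unfolding parking_function_def by (metis vec_lambda_beta)
qed

lemma unit_cube_convex_hull_corners:
  "cbox 0 (1 :: real ^ 'n::finite) = convex hull {x. \<forall>i. x $ i = 0 \<or> x $ i = 1}"
proof -
  have "{x :: real ^ 'n. \<forall>i\<in>Basis. x \<bullet> i = 0 \<or> x \<bullet> i = 1} = {x. \<forall>i. x $ i = 0 \<or> x $ i = 1}"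
    by (simp add: Basis_vec_def inner_axis)
  then show ?thesis
    unfolding Cart_1 unit_interval_convex_hull by simp
qed

text \<open>The box is the image of the unit cube under an affine map, so it is the convex hull of its
  corners; each corner has all entries equal to \<open>1\<close> or to the bound
  and hence is a parking function.\<close>

lemma permuted_box_in_parking_polytope:
  fixes b :: "int ^ 'n::{finite,linorder}" and y :: "real ^ 'n::{finite,linorder}"
  assumes b: "\<And>i. 0 < b $ i" and \<sigma>: "\<sigma> permutes UNIV"
    and y: "\<And>i. 1 \<le> y $ \<sigma> i" "\<And>i. y $ \<sigma> i \<le> real_of_int (\<Sum>j\<le>i. b $ j)"
  shows "y \<in> parking_polytope b"
proof -
  define s where "s k = (\<Sum>j\<le>inv \<sigma> k. b $ j)" for k
  have inv: "\<sigma> (inv \<sigma> k) = k" "inv \<sigma> (\<sigma> k) = k" for k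
    using permutes_inverses[OF \<sigma>] by simp_all
  have s_pos: "0 < s k" for k
    unfolding s_def by (rule sum_pos) (use b in auto)
  have y1: "1 \<le> y $ k" and ys: "y $ k \<le> s k" for k
    using y[of "inv \<sigma> k"] by (simp_all add: inv s_def)
  define D :: "real ^ 'n::{finite,linorder} \<Rightarrow> real ^ 'n::{finite,linorder}"
    where "D u = (\<chi> k. (real_of_int (s k) - 1) * u $ k)" for u
  have "linear D"
    by (rule linearI) (simp_all add: D_def vec_eq_iff algebra_simps)
  \<comment> \<open>In a degenerate direction (\<open>s k = 1\<close>) division by zero makes the cube coordinate \<open>0\<close>,
    which is right because \<open>y $ k = 1\<close> there.\<close>
  define u :: "real ^ 'n::{finite,linorder}"
    where "u = (\<chi> k. (y $ k - 1) / (real_of_int (s k) - 1))"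
  have "0 \<le> u $ k \<and> u $ k \<le> 1" for k
    using y1[of k] ys[of k] by (auto simp: u_def divide_le_eq_1)
  then have "u \<in> cbox 0 1"
    by (auto simp: mem_box_cart)
  then have u: "u \<in> convex hull {x. \<forall>i. x $ i = 0 \<or> x $ i = 1}"
    by (simp only: unit_cube_convex_hull_corners)
  have "(real_of_int (s k) - 1) * u $ k = y $ k - 1" for k
    using y1[of k] ys[of k] by (auto simp: u_def)
  then have "y = vec 1 + D u"
    by (simp add: vec_eq_iff D_def)
  also have "\<dots> \<in> (+) (vec 1) ` D ` (convex hull {x. \<forall>i. x $ i = 0 \<or> x $ i = 1})"
    by (intro imageI u)
  also have "\<dots> = convex hull ((+) (vec 1) ` D ` {x. \<forall>i. x $ i = 0 \<or> x $ i = 1})"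
    by (simp only: convex_hull_linear_image[OF \<open>linear D\<close>] convex_hull_translation)
  also have "\<dots> \<subseteq> parking_polytope b"
    unfolding parking_polytope_def
  proof (rule hull_mono, safe)
    fix v :: "real ^ 'n::{finite,linorder}"
    assume v: "\<forall>i. v $ i = 0 \<or> v $ i = 1"
    define \<beta> :: "int ^ 'n::{finite,linorder}" where "\<beta> = (\<chi> k. if v $ k = 0 then 1 else s k)"
    have "1 \<le> s k" for k
      using s_pos[of k] by simp
    then have "\<beta> $ \<sigma> i \<le> s (\<sigma> i)" for i
      by (simp add: \<beta>_def)
    then have "\<beta> $ \<sigma> i \<le> (\<Sum>j\<le>i. b $ j)" for i
      by (simp add: s_def inv)
    moreover have "0 < \<beta> $ k" for k
      using s_pos by (simp add: \<beta>_def)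
    ultimately have "parking_function b \<beta>"
      unfolding parking_function_iff_fits_below[OF b] using \<sigma> by blast
    moreover have "vec 1 + D v = (\<chi> i. real_of_int (\<beta> $ i))"
      using v by (auto simp: vec_eq_iff D_def \<beta>_def)
    ultimately show "\<exists>\<beta>. vec 1 + D v = (\<chi> i. real_of_int (\<beta> $ i)) \<and> parking_function b \<beta>"
      by (intro exI conjI)
  qed
  finally show ?thesis .
qed

text \<open>The exceptional first entry contributes the summand \<open>1 - t\<close>, once, to every partial sum.\<close>

lemma sum_dilated_params:
  fixes b :: "int ^ 'n::{finite,linorder}"
  shows "(\<Sum>j\<le>i. dilated_params t b $ j) = t * ((\<Sum>j\<le>i. b $ j) - 1) + 1"
proof -
  have "(\<Sum>j\<le>i. dilated_params t b $ j) = (\<Sum>j\<le>i. t * b $ j + (if j = Min UNIV then 1 - t else 0))"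
    by (rule sum.cong) (auto simp: dilated_params_def algebra_simps)
  also have "\<dots> = t * (\<Sum>j\<le>i. b $ j) + (1 - t)"
    by (simp add: sum.distrib sum_distrib_left)
  finally show ?thesis
    by (simp add: algebra_simps)
qed

text \<open>Both sides are convex hulls, so it suffices to place the generators of each side in the other.
  From left to right generators go to generators.  From right to left a generator may fall between
  the integer points scaled by \<open>t\<close>; this is where the real box is needed.\<close>

lemma dilated_parking_polytope:
  fixes b :: "int ^ 'n::{finite,linorder}" and t :: int
  assumes b: "\<And>i. 0 < b $ i" and t: "0 < t"
  shows "(*\<^sub>R) (real_of_int t) ` parking_polytope b =
           (+) ((real_of_int t - 1) *\<^sub>R vec 1) ` parking_polytope (dilated_params t b)"
proof -
  let ?c = "(real_of_int t - 1) *\<^sub>R vec 1 :: real ^ 'n::{finite,linorder}"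
  let ?G = "\<lambda>b :: int ^ 'n::{finite,linorder}. {(\<chi> i. real_of_int (\<beta> $ i)) | \<beta>. parking_function b \<beta>}"
  note fits = parking_function_iff_fits_below[OF b]
    parking_function_iff_fits_below[OF dilated_params_pos[OF b t]]
  have L: "(*\<^sub>R) (real_of_int t) ` parking_polytope b = convex hull ((*\<^sub>R) (real_of_int t) ` ?G b)"
    unfolding parking_polytope_def by (simp only: convex_hull_scaling)
  have R: "(+) ?c ` parking_polytope (dilated_params t b) =
      convex hull ((+) ?c ` ?G (dilated_params t b))"
    unfolding parking_polytope_def by (simp only: convex_hull_translation)
  show ?thesis
  proof
    have "(*\<^sub>R) (real_of_int t) ` ?G b \<subseteq> (+) ?c ` ?G (dilated_params t b)"
    proof safe
      fix \<beta> assume "parking_function b \<beta>"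
      then obtain \<sigma> where pos: "\<And>i. 0 < \<beta> $ i" and \<sigma>: "\<sigma> permutes UNIV"
        and le: "\<And>i. \<beta> $ \<sigma> i \<le> (\<Sum>j\<le>i. b $ j)"
        unfolding fits by blast
      define \<gamma> :: "int ^ 'n::{finite,linorder}" where "\<gamma> = (\<chi> i. t * (\<beta> $ i - 1) + 1)"
      have "0 < \<gamma> $ i" for i
      proof -
        have "0 \<le> t * (\<beta> $ i - 1)"
          using pos[of i] t by simp
        then show ?thesis
          by (simp add: \<gamma>_def)
      qed
      moreover have "\<gamma> $ \<sigma> i \<le> (\<Sum>j\<le>i. dilated_params t b $ j)" for i
        using le[of i] t by (simp add: \<gamma>_def sum_dilated_params)
      ultimately have "parking_function (dilated_params t b) \<gamma>"
        unfolding fits using \<sigma> by blast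
      then have "(\<chi> i. real_of_int (\<gamma> $ i)) \<in> ?G (dilated_params t b)"
        by blast
      moreover have "real_of_int t *\<^sub>R (\<chi> i. real_of_int (\<beta> $ i)) = ?c + (\<chi> i. real_of_int (\<gamma> $ i))"
        by (simp add: vec_eq_iff \<gamma>_def algebra_simps)
      ultimately show "real_of_int t *\<^sub>R (\<chi> i. real_of_int (\<beta> $ i)) \<in> (+) ?c ` ?G (dilated_params t b)"
        by (rule rev_image_eqI)
    qed
    then show "(*\<^sub>R) (real_of_int t) ` parking_polytope b \<subseteq>
        (+) ?c ` parking_polytope (dilated_params t b)"
      unfolding L R by (rule hull_mono)
  next
    have "(+) ?c ` ?G (dilated_params t b) \<subseteq> (*\<^sub>R) (real_of_int t) ` parking_polytope b"
    proof safe
      fix \<gamma> assume "parking_function (dilated_params t b) \<gamma>"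
      then obtain \<sigma> where pos: "\<And>i. 0 < \<gamma> $ i" and \<sigma>: "\<sigma> permutes UNIV"
        and le: "\<And>i. \<gamma> $ \<sigma> i \<le> t * ((\<Sum>j\<le>i. b $ j) - 1) + 1"
        unfolding fits sum_dilated_params by blast
      define y :: "real ^ 'n::{finite,linorder}" where "y = (\<chi> i. (real_of_int (\<gamma> $ i) - 1) / t + 1)"
      have "1 \<le> y $ k" for k
        using pos[of k] t by (simp add: y_def)
      moreover have "y $ \<sigma> i \<le> real_of_int (\<Sum>j\<le>i. b $ j)" for i
      proof -
        have "real_of_int (\<gamma> $ \<sigma> i) \<le> real_of_int (t * ((\<Sum>j\<le>i. b $ j) - 1) + 1)"
          using le[of i] by (simp only: of_int_le_iff)
        then have "(real_of_int (\<gamma> $ \<sigma> i) - 1) / t \<le> real_of_int (\<Sum>j\<le>i. b $ j) - 1"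
          using t by (simp add: divide_le_eq mult.commute)
        then show ?thesis
          by (simp add: y_def)
      qed
      ultimately have "y \<in> parking_polytope b"
        using permuted_box_in_parking_polytope[OF b \<sigma>] by blast
      moreover have "?c + (\<chi> i. real_of_int (\<gamma> $ i)) = real_of_int t *\<^sub>R y"
        using t by (simp add: vec_eq_iff y_def field_simps)
      ultimately show "?c + (\<chi> i. real_of_int (\<gamma> $ i)) \<in> (*\<^sub>R) (real_of_int t) ` parking_polytope b"
        by (rule rev_image_eqI)
    qed
    then show "(+) ?c ` parking_polytope (dilated_params t b) \<subseteq>
        (*\<^sub>R) (real_of_int t) ` parking_polytope b"
      unfolding R by (rule hull_minimal) (simp add: L convex_convex_hull)
  qed
qed

lemma card_integer_points_translation:
  fixes c :: "real ^ 'n::finite"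
  assumes "c \<in> integer_points"
  shows "card ((+) c ` P \<inter> integer_points) = card (P \<inter> integer_points)"
proof -
  have "c + x \<in> integer_points \<longleftrightarrow> x \<in> integer_points" for x
    using assms by (simp add: integer_points_def)
  then have "(+) c ` P \<inter> integer_points = (+) c ` (P \<inter> integer_points)"
    by auto
  then show ?thesis
    by (simp add: card_image)
qed

theorem lemma5p1:
  fixes b :: "int ^ 'n::{finite,linorder}" and t :: int
  assumes "\<And>i. 0 < b $ i" and "0 < t"
  shows "(*\<^sub>R) (real_of_int t) ` parking_polytope b =
           (+) ((real_of_int t - 1) *\<^sub>R vec 1) ` parking_polytope (dilated_params t b) \<and>
         card ((*\<^sub>R) (real_of_int t) ` parking_polytope b \<inter> integer_points) =
           card (parking_polytope (dilated_params t b) \<inter> integer_points)"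
proof -
  have "(real_of_int t - 1) *\<^sub>R vec 1 \<in> (integer_points :: (real ^ 'n::{finite,linorder}) set)"
    by (simp add: integer_points_def)
  then show ?thesis
    by (simp only: dilated_parking_polytope[OF assms] card_integer_points_translation simp_thms)
qed

end
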